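(* Let $r\ge 2$ be a fixed integer and let $p=p(n)$ satisfy $\Omega(1)=p\le 1-o(1)$. Then, a.a.s., \[ \frac{(1+o(1))\,n}{r -p - r(1-p)^r+ (pr+1)(1-p)^rp^{-2}} \le \ell_{\max} \le (1+o(1))\,n\left(\frac{1}{r} + \frac{1}{r(r-2+p^{-1})} \right), \] where $\ell_{\max}$ is the maximal length of an ordered loose path in the random $r$-uniform hypergraph $H^{(r)}(n,p)$.
   Context: Let $r\ge 2$ be a fixed integer (constant). $H=H^{(r)}(n,p)$ is the random $r$-uniform hypergraph on the vertex set $[n]=\{1,\dots,n\}$ in which each $r$-element subset of $[n]$ is included as an edge independently with probability $p=p(n)\in[0,1]$. An ordered loose path of length $\ell$ in $H$ is an increasing sequence of vertices $v_1<v_2<\dots<v_{\ell(r-1)+1}$ in $[n]$ such that the $\ell$ sets $\{v_{(k-1)(r-1)+1},v_{(k-1)(r-1)+2},\dots,v_{k(r-1)+1}\}$, $k=1,\dots,\ell$, are all edges of $H$ (so every two consecutive edges intersect in a single vertex). $\ell_{\max}$ denotes the maximal length of an ordered loose path in $H$. All asymptotics are as $n\to\infty$; "a.a.s." means with probability tending to $1$ as $n\to\infty$. The condition $\Omega(1)=p\le 1-o(1)$ means that $p(n)$ is bounded below by a positive constant for all large $n$ and $p(n)\le 1-\varepsilon_n$ for some $\varepsilon_n\to0$. The factors $1+o(1)$ denote deterministic sequences tending to $1$ as $n\to\infty$. *)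

theory Defs
  imports "HOL-Probability.Probability" "HOL-Library.Landau_Symbols"
begin

text \<open>A hypergraph on the vertex set \<open>{1..n}\<close> is represented by its set of edges.\<close>

definition potential_edges :: "nat \<Rightarrow> nat \<Rightarrow> nat set set" where
  "potential_edges r n = {e. e \<subseteq> {1..n} \<and> card e = r}"

definition random_hypergraph :: "nat \<Rightarrow> nat \<Rightarrow> real \<Rightarrow> nat set set pmf" where
  "random_hypergraph r n p =
     map_pmf (\<lambda>f. {e. f e}) (Pi_pmf (potential_edges r n) False (\<lambda>_. bernoulli_pmf p))"

text \<open>Only the values of \<open>v\<close> on \<open>{1..l * (r - 1) + 1}\<close> matter. The case \<open>l = 0\<close> is a single vertex.\<close>

definition ordered_loose_path ::
  "nat \<Rightarrow> nat \<Rightarrow> nat set set \<Rightarrow> nat \<Rightarrow> (nat \<Rightarrow> nat) \<Rightarrow> bool" where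
  "ordered_loose_path r n H l v \<longleftrightarrow>
     strict_mono_on {1..l * (r - 1) + 1} v \<and>
     v ` {1..l * (r - 1) + 1} \<subseteq> {1..n} \<and>
     (\<forall>k\<in>{1..l}. v ` {(k - 1) * (r - 1) + 1..k * (r - 1) + 1} \<in> H)"

text \<open>For \<open>n \<ge> 1\<close> and \<open>r \<ge> 2\<close> the maximum is over a finite nonempty set, as shown below;
  for \<open>n = 0\<close> there is no path and the value is unspecified.\<close>

definition max_path_length :: "nat \<Rightarrow> nat \<Rightarrow> nat set set \<Rightarrow> nat" where
  "max_path_length r n H = Max {l. \<exists>v. ordered_loose_path r n H l v}"

lemma ordered_loose_path_length_le:
  assumes "r \<ge> 2" "ordered_loose_path r n H l v"
  shows "l < n"
proof -
  let ?I = "{1..l * (r - 1) + 1}"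
  have "inj_on v ?I"
    using assms(2) strict_mono_on_imp_inj_on unfolding ordered_loose_path_def by blast
  moreover have "v ` ?I \<subseteq> {1..n}"
    using assms(2) unfolding ordered_loose_path_def by blast
  ultimately have "card ?I \<le> card {1..n}"
    by (intro card_inj_on_le) auto
  then have "l * (r - 1) < n"
    by simp
  moreover have "l \<le> l * (r - 1)"
    using assms(1) mult_le_mono2[of 1 "r - 1" l] by linarith
  ultimately show ?thesis
    by linarith
qed

lemma finite_path_lengths:
  assumes "r \<ge> 2"
  shows "finite {l. \<exists>v. ordered_loose_path r n H l v}"
  by (rule finite_subset[of _ "{..<n}"]) (use ordered_loose_path_length_le[OF assms] in auto)

lemma path_lengths_nonempty:
  assumes "n \<ge> 1"
  shows "{l. \<exists>v. ordered_loose_path r n H l v} \<noteq> {}"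
proof -
  have "ordered_loose_path r n H 0 (\<lambda>_. 1)"
    using assms by (auto simp: ordered_loose_path_def strict_mono_on_def)
  then show ?thesis
    by blast
qed

end

theory Submission
  imports Defs
begin

text \<open>Lower bound: from the current last vertex \<open>v\<close>, extend the path by the edge with first vertex
  \<open>v\<close> whose last vertex is smallest. The number of sets with first vertex \<open>v\<close> and last vertex at
  most \<open>v + r - 1 + i\<close> is \<open>(r - 1 + i) choose (r - 1) \<ge> r - 1 + i\<close>, so with \<open>q = 1 - p\<close> the mean
  advance is at most \<open>r - 1 + q + q^r / p\<close>, which is at most the denominator in the theorem.
  Upper bound: an edge of a path either is an interval of \<open>r\<close> consecutive vertices or advances the
  path by at least \<open>r\<close>, so \<open>r l\<close> is at most \<open>n\<close> plus the largest number of interval edges that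
  pairwise share at most one vertex. Scanning from the left finds such a largest family, and each
  of its members uses up \<open>r - 2 + 1 / p\<close> vertices on average. In both cases the next decision only
  involves edges that are independent of everything to the right, so backward induction on the
  vertex bounds the exponential moments, and Markov's inequality gives exponentially small tails.\<close>

subsection \<open>Independence in the random hypergraph\<close>

lemma finite_potential_edges [simp]: "finite (potential_edges r n)"
  by (rule finite_subset[of _ "Pow {1..n}"]) (auto simp: potential_edges_def)

lemma expectation_pair_pmf_mult:
  fixes f :: "'a \<Rightarrow> real" and g :: "'b \<Rightarrow> real"
  assumes "finite (set_pmf P)" "finite (set_pmf Q)"
  shows "measure_pmf.expectation (pair_pmf P Q) (\<lambda>(x, y). f x * g y) =
    measure_pmf.expectation P f * measure_pmf.expectation Q g"
proof -
  let ?P = "set_pmf P" and ?Q = "set_pmf Q"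
  have "measure_pmf.expectation (pair_pmf P Q) (\<lambda>(x, y). f x * g y) =
      (\<Sum>z\<in>?P \<times> ?Q. (case z of (x, y) \<Rightarrow> f x * g y) * pmf (pair_pmf P Q) z)"
    using assms by (intro integral_measure_pmf_real) auto
  also have "\<dots> = (\<Sum>x\<in>?P. f x * pmf P x) * (\<Sum>y\<in>?Q. g y * pmf Q y)"
    unfolding sum_product sum.cartesian_product
    by (intro sum.cong) (auto simp: pmf_pair mult_ac)
  also have "\<dots> = measure_pmf.expectation P f * measure_pmf.expectation Q g"
    using assms by (simp add: integral_measure_pmf_real[of ?P] integral_measure_pmf_real[of ?Q])
  finally show ?thesis .
qed

lemma finite_set_pmf_Pi_bernoulli:
  assumes "finite A"
  shows "finite (set_pmf (Pi_pmf A False (\<lambda>_. bernoulli_pmf p)))"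
  using assms by (intro finite_subset[OF set_Pi_pmf_subset'] finite_PiE_dflt) auto

lemma finite_set_random_hypergraph [simp]: "finite (set_pmf (random_hypergraph r n p))"
  by (simp add: random_hypergraph_def finite_set_pmf_Pi_bernoulli)

lemma integrable_random_hypergraph [simp]:
  fixes X :: "nat set set \<Rightarrow> real"
  shows "integrable (random_hypergraph r n p) X"
  by (rule integrable_measure_pmf_finite) simp

text \<open>Edges inside \<open>A\<close> and edges outside \<open>A\<close> are decided by disjoint
  families of coin flips, so the law of the hypergraph is a product. The two hypotheses express that
  \<open>X\<close> looks only at the first family and \<open>Y\<close> only at the second.\<close>

lemma expectation_random_hypergraph_mult:
  fixes X Y :: "nat set set \<Rightarrow> real"
  assumes X: "\<And>H. X (H \<inter> A) = X H" and Y: "\<And>H. Y (H - A) = Y H"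
  shows "measure_pmf.expectation (random_hypergraph r n p) (\<lambda>H. X H * Y H) =
    measure_pmf.expectation (random_hypergraph r n p) X *
    measure_pmf.expectation (random_hypergraph r n p) Y"
proof -
  define E1 where "E1 = potential_edges r n \<inter> A"
  define E2 where "E2 = potential_edges r n - A"
  define P where "P = (\<lambda>E :: nat set set. Pi_pmf E False (\<lambda>_. bernoulli_pmf p))"
  define u where "u = (\<lambda>(f :: nat set \<Rightarrow> bool, g) e. if e \<in> E1 then f e else g e)"
  have fin [simp]: "finite E1" "finite E2"
    by (auto simp: E1_def E2_def)
  have split: "random_hypergraph r n p = map_pmf (\<lambda>f. {e. f e}) (map_pmf u (pair_pmf (P E1) (P E2)))"
  proof -
    have "potential_edges r n = E1 \<union> E2" "E1 \<inter> E2 = {}"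
      by (auto simp: E1_def E2_def)
    then show ?thesis
      by (simp add: random_hypergraph_def Pi_pmf_union P_def u_def)
  qed
  have supp: "{e. u (f, g) e} \<inter> A = {e. f e} \<inter> A" "{e. u (f, g) e} - A = {e. g e} - A"
    if "f \<in> set_pmf (P E1)" "g \<in> set_pmf (P E2)" for f g
  proof -
    have "\<forall>e. e \<notin> E1 \<longrightarrow> \<not> f e" "\<forall>e. e \<notin> E2 \<longrightarrow> \<not> g e"
      using subsetD[OF set_Pi_pmf_subset[OF fin(1)] that(1)[unfolded P_def]]
        subsetD[OF set_Pi_pmf_subset[OF fin(2)] that(2)[unfolded P_def]] by simp_all
    then show "{e. u (f, g) e} \<inter> A = {e. f e} \<inter> A" "{e. u (f, g) e} - A = {e. g e} - A"
      by (auto simp: u_def E1_def E2_def)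
  qed
  have XY: "X {e. u (f, g) e} = X {e. f e}" "Y {e. u (f, g) e} = Y {e. g e}"
    if "f \<in> set_pmf (P E1)" "g \<in> set_pmf (P E2)" for f g
    using supp[OF that] X[of "{e. u (f, g) e}"] X[of "{e. f e}"]
      Y[of "{e. u (f, g) e}"] Y[of "{e. g e}"] by simp_all
  have fs: "finite (set_pmf (P E1))" "finite (set_pmf (P E2))"
    by (simp_all add: P_def finite_set_pmf_Pi_bernoulli)
  \<comment> \<open>Stated for arbitrary factors so that it can be used three times: for the product
    itself, and with one factor equal to 1, which identifies each marginal expectation with the one
    over the whole hypergraph.\<close>
  have main: "measure_pmf.expectation (random_hypergraph r n p) (\<lambda>H. F H * G H) =
      measure_pmf.expectation (P E1) (\<lambda>f. F' {e. f e}) * measure_pmf.expectation (P E2) (\<lambda>g. G' {e. g e})"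
    if "\<And>f g. f \<in> set_pmf (P E1) \<Longrightarrow> g \<in> set_pmf (P E2) \<Longrightarrow> F {e. u (f, g) e} = F' {e. f e}"
      "\<And>f g. f \<in> set_pmf (P E1) \<Longrightarrow> g \<in> set_pmf (P E2) \<Longrightarrow> G {e. u (f, g) e} = G' {e. g e}"
    for F G F' G' :: "nat set set \<Rightarrow> real"
  proof -
    have "measure_pmf.expectation (random_hypergraph r n p) (\<lambda>H. F H * G H) =
      measure_pmf.expectation (pair_pmf (P E1) (P E2)) (\<lambda>(f, g). F' {e. f e} * G' {e. g e})"
      using that unfolding split by (auto intro!: integral_cong_AE simp: AE_measure_pmf_iff)
    then show ?thesis
      by (simp add: expectation_pair_pmf_mult[OF fs])
  qed
  show ?thesis
    using main[of X X Y Y, OF XY] main[of X X "\<lambda>_. 1" "\<lambda>_. 1", OF XY(1)]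
      main[of "\<lambda>_. 1" "\<lambda>_. 1" Y Y, OF _ XY(2)] by simp
qed

lemma prob_random_hypergraph_no_edges:
  assumes "S \<subseteq> potential_edges r n" "0 \<le> p" "p \<le> 1"
  shows "measure_pmf.prob (random_hypergraph r n p) {H. H \<inter> S = {}} = (1 - p) ^ card S"
proof -
  let ?E = "potential_edges r n"
  let ?B = "\<lambda>e. if e \<in> S then {False} else UNIV"
  have "(\<lambda>f. {e. f e}) -` {H. H \<inter> S = {}} = Pi ?E ?B"
    using assms(1) by (auto simp: Pi_def split: if_splits)
  then have "measure_pmf.prob (random_hypergraph r n p) {H. H \<inter> S = {}} =
      (\<Prod>e\<in>?E. measure_pmf.prob (bernoulli_pmf p) (?B e))"
    unfolding random_hypergraph_def by (simp add: measure_Pi_pmf_Pi)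
  also have "\<dots> = (\<Prod>e\<in>S. measure_pmf.prob (bernoulli_pmf p) (?B e))"
    using assms(1) by (intro prod.mono_neutral_right) auto
  also have "\<dots> = (1 - p) ^ card S"
    using assms by (simp add: measure_pmf_single)
  finally show ?thesis .
qed

subsection \<open>Interval edges\<close>

text \<open>After a hit the scan resumes at the last vertex of the interval, which the next interval
  may share. Writing that vertex as \<open>Suc (v + (r - 2))\<close> makes the argument grow for
  every \<open>r\<close>, so that the recursion terminates; for \<open>r \<ge> 2\<close> it is
  \<open>v + r - 1\<close>.\<close>

function greedy_intervals :: "nat \<Rightarrow> nat \<Rightarrow> nat set set \<Rightarrow> nat \<Rightarrow> nat" where
  "greedy_intervals r n H v =
     (if n < v then 0
      else if {v..<v + r} \<in> H then Suc (greedy_intervals r n H (Suc (v + (r - 2))))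
      else greedy_intervals r n H (Suc v))"
  by auto
termination
  by (relation "Wellfounded.measure (\<lambda>(r, n, H, v). Suc n - v)") auto

declare greedy_intervals.simps [simp del]

lemma greedy_intervals_beyond: "n < v \<Longrightarrow> greedy_intervals r n H v = 0"
  by (simp add: greedy_intervals.simps)

lemma greedy_intervals_hit:
  assumes "r \<ge> 2" "v \<le> n" "{v..<v + r} \<in> H"
  shows "greedy_intervals r n H v = Suc (greedy_intervals r n H (v + r - 1))"
proof -
  have "Suc (v + (r - 2)) = v + r - 1"
    using assms(1) by simp
  then show ?thesis
    using assms by (subst greedy_intervals.simps) (simp del: add_Suc_right)
qed

lemma greedy_intervals_miss:
  assumes "v \<le> n" "{v..<v + r} \<notin> H"
  shows "greedy_intervals r n H v = greedy_intervals r n H (Suc v)"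
  using assms by (subst greedy_intervals.simps) simp

text \<open>This is the optimality of the greedy scan. The two claims are proved together because
  each feeds the other: after a hit at \<open>v\<close>, the first one is the second one at
  \<open>Suc v\<close> with \<open>d = r - 2\<close>, while the second one is monotonicity to the
  right of \<open>v\<close>.\<close>

lemma greedy_intervals_step:
  assumes "r \<ge> 2"
  shows "greedy_intervals r n H (Suc v) \<le> greedy_intervals r n H v \<and>
    (\<forall>d<r. greedy_intervals r n H v \<le> Suc (greedy_intervals r n H (v + d)))"
proof (induction "Suc n - v" arbitrary: v rule: less_induct)
  case less
  let ?G = "greedy_intervals r n H"
  show ?case
  proof (cases "n < v")
    case True
    then show ?thesis
      by (simp add: greedy_intervals_beyond)
  next
    case False
    have IH: "?G (Suc w) \<le> ?G w" "d < r \<Longrightarrow> ?G w \<le> Suc (?G (w + d))" if "v < w" for w d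
      using less[of w] that False by auto
    have mono: "?G y \<le> ?G x" if "v < x" "x \<le> y" for x y
      using that(2)
    proof (induction y rule: dec_induct)
      case (step y)
      then show ?case
        using IH(1)[of y] that(1) by linarith
    qed simp
    show ?thesis
    proof (cases "{v..<v + r} \<in> H")
      case True
      have eq: "?G v = Suc (?G (v + r - 1))"
        using True False assms by (simp add: greedy_intervals_hit)
      have "?G (Suc v) \<le> ?G v"
      proof -
        have "Suc v + (r - 2) = v + r - 1"
          using assms by simp
        then show ?thesis
          using IH(2)[of "Suc v" "r - 2"] assms by (simp add: eq del: add_Suc)
      qed
      moreover have "?G v \<le> Suc (?G (v + d))" if "d < r" for d
        using mono[of "v + d" "v + r - 1"] that by (cases "d = 0") (auto simp: eq)
      ultimately show ?thesis
        by blast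
    next
      case miss: False
      have eq: "?G v = ?G (Suc v)"
        using miss False by (simp add: greedy_intervals_miss)
      have "?G v \<le> Suc (?G (v + d))" if "d < r" for d
        using IH(2)[of "Suc v" "d - 1"] that by (cases "d = 0") (auto simp: eq)
      then show ?thesis
        using eq by simp
    qed
  qed
qed

lemma greedy_intervals_antimono:
  assumes "r \<ge> 2" "u \<le> v"
  shows "greedy_intervals r n H v \<le> greedy_intervals r n H u"
  by (rule lift_Suc_antimono_le[OF _ assms(2)]) (use greedy_intervals_step[OF assms(1)] in blast)

text \<open>Each edge is charged \<open>r\<close>. A non-interval edge pays by advancing at least
  \<open>r\<close> vertices; an interval edge advances only \<open>r - 1\<close> and pays the
  missing unit with one greedy hit.\<close>

lemma path_length_le_greedy_intervals:
  assumes r: "r \<ge> 2" and path: "ordered_loose_path r n H l w"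
  shows "r * l \<le> n + greedy_intervals r n H 1"
proof -
  let ?G = "greedy_intervals r n H"
  define s where "s k = w (k * (r - 1) + 1)" for k
  have in_n: "s k \<in> {1..n}" if "k \<le> l" for k
    using path that mult_le_mono1[OF that, of "r - 1"] by (auto simp: ordered_loose_path_def s_def image_subset_iff)
  \<comment> \<open>The \<open>r\<close> vertices of an edge lie between two consecutive joints
    \<open>s k\<close> and \<open>s (Suc k)\<close>. If the advance is the minimal
    \<open>r - 1\<close>, there is no room for a gap and the edge is the whole interval.\<close>
  have adv: "s (Suc k) \<ge> s k + r - 1 \<and> (s (Suc k) = s k + r - 1 \<longrightarrow> {s k..<s k + r} \<in> H)"
    if k: "k < l" for k
  proof -
    let ?I = "{k * (r - 1) + 1..Suc k * (r - 1) + 1}"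
    have sub: "?I \<subseteq> {1..l * (r - 1) + 1}"
      using mult_le_mono1[of "Suc k" l "r - 1"] k by auto
    have sm: "strict_mono_on ?I w"
      using monotone_on_subset[OF _ sub] path unfolding ordered_loose_path_def by blast
    have edge: "w ` ?I \<in> H"
    proof -
      have "Suc k \<in> {1..l}"
        using k by simp
      then have "w ` {(Suc k - 1) * (r - 1) + 1..Suc k * (r - 1) + 1} \<in> H"
        using path unfolding ordered_loose_path_def by blast
      then show ?thesis
        by simp
    qed
    have card: "card (w ` ?I) = r"
      using r strict_mono_on_imp_inj_on[OF sm] by (simp add: card_image)
    have range: "w ` ?I \<subseteq> {s k..s (Suc k)}"
      using sm by (auto simp: s_def strict_mono_on_leD)
    have le: "r \<le> card {s k..s (Suc k)}"
      using card_mono[OF _ range] card by simp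
    have "w ` ?I = {s k..<s k + r}" if "s (Suc k) = s k + r - 1"
    proof -
      have "{s k..s (Suc k)} = {s k..<s k + r}"
        using that r by auto
      then show ?thesis
        using range card by (metis card_atLeastLessThan card_subset_eq diff_add_inverse finite_atLeastLessThan)
    qed
    then show ?thesis
      using le r edge by auto
  qed
  \<comment> \<open>Induction from the last joint back to the first. Where the path does not use an
    interval, antimonotonicity of the greedy count is enough, so the greedy hits need not coincide
    with edges of the path.\<close>
  have "r * (l - k) + s k \<le> n + ?G (s k)" if "k \<le> l" for k
    using that
  proof (induction k rule: inc_induct)
    case base
    then show ?case
      using in_n[of l] by simp
  next
    case (step k)
    have eq: "r * (l - k) = r + r * (l - Suc k)"
      using step.hyps by (metis Suc_diff_Suc mult_Suc_right)
    show ?case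
    proof (cases "s (Suc k) = s k + r - 1")
      case True
      then have "?G (s k) = Suc (?G (s (Suc k)))"
        using adv[of k] step.hyps r in_n[of k] by (simp add: greedy_intervals_hit)
      then show ?thesis
        using step.IH eq True r by linarith
    next
      case False
      then have "s k + r \<le> s (Suc k)"
        using adv[of k] step.hyps by auto
      moreover have "?G (s (Suc k)) \<le> ?G (s k)"
        using calculation by (intro greedy_intervals_antimono r) simp
      ultimately show ?thesis
        using step.IH eq by linarith
    qed
  qed
  from this[of 0] have "r * l + s 0 \<le> n + ?G (s 0)"
    by simp
  moreover have "?G (s 0) \<le> ?G 1"
    using in_n[of 0] by (intro greedy_intervals_antimono r) auto
  ultimately show ?thesis
    by linarith
qed

section \<open>Exponential moments of the greedy interval count\<close>

text \<open>A scan started at \<open>v\<close> inspects only sets without vertices below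
  \<open>v\<close>. This supplies the invariance required for independence.\<close>

lemma greedy_intervals_Diff:
  assumes "\<And>e. e \<in> A \<Longrightarrow> \<exists>x\<in>e. x < v"
  shows "greedy_intervals r n (H - A) v = greedy_intervals r n H v"
  using assms
proof (induction "Suc n - v" arbitrary: v rule: less_induct)
  case less
  have "{v..<v + r} \<in> H - A \<longleftrightarrow> {v..<v + r} \<in> H"
    using less.prems[of "{v..<v + r}"] by force
  moreover have "greedy_intervals r n (H - A) (Suc (v + d)) = greedy_intervals r n H (Suc (v + d))"
    if "\<not> n < v" for d
  proof (intro less.hyps)
    show "\<exists>x\<in>e. x < Suc (v + d)" if "e \<in> A" for e
      using less.prems[OF that] less_SucI trans_less_add1 by blast
  qed (use that in simp)
  from this[of "r - 2"] this[of 0]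
  have "\<not> n < v \<Longrightarrow> greedy_intervals r n (H - A) (Suc (v + (r - 2))) = greedy_intervals r n H (Suc (v + (r - 2)))"
    "\<not> n < v \<Longrightarrow> greedy_intervals r n (H - A) (Suc v) = greedy_intervals r n H (Suc v)"
    by simp_all
  ultimately show ?case
    unfolding greedy_intervals.simps[of r n "H - A" v] greedy_intervals.simps[of r n H v]
    by presburger
qed

lemma prob_random_hypergraph_edge:
  assumes "e \<in> potential_edges r n" "0 \<le> p" "p \<le> 1"
  shows "measure_pmf.prob (random_hypergraph r n p) {H. e \<in> H} = p"
proof -
  have "measure_pmf.prob (random_hypergraph r n p) (UNIV - {H. H \<inter> {e} = {}}) = 1 - (1 - p)"
    using prob_random_hypergraph_no_edges[of "{e}" r n p] assms
    by (subst measure_pmf.prob_compl[of _ "random_hypergraph r n p", simplified]) auto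
  moreover have "UNIV - {H. H \<inter> {e} = {}} = {H. e \<in> H}"
    by auto
  ultimately show ?thesis
    by simp
qed

lemma prob_random_hypergraph_non_edge:
  assumes "e \<notin> potential_edges r n"
  shows "measure_pmf.prob (random_hypergraph r n p) {H. e \<in> H} = 0"
proof -
  have "f e = False" if "f \<in> set_pmf (Pi_pmf (potential_edges r n) False (\<lambda>_. bernoulli_pmf p))" for f
    using subsetD[OF set_Pi_pmf_subset that] assms by simp
  then have "set_pmf (random_hypergraph r n p) \<inter> {H. e \<in> H} = {}"
    by (auto simp: random_hypergraph_def)
  then show ?thesis
    by (simp add: measure_pmf_zero_iff)
qed

text \<open>Backward induction on \<open>v\<close>, conditioning on whether the interval at
  \<open>v\<close> is an edge. Each scanned vertex costs a factor \<open>z\<close>, and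
  \<open>wz\<close> is the resulting one-step inequality. The shift by \<open>r\<close> leaves room
  for a hit near the right end, after which the scan may resume beyond \<open>n\<close>.\<close>

lemma expectation_greedy_intervals_le:
  fixes p w z :: real
  assumes r: "r \<ge> 2" and p: "0 \<le> p" "p \<le> 1" and w: "w \<ge> 1" and z: "z \<ge> 1"
    and wz: "p * w + (1 - p) * z ^ (r - 2) \<le> z ^ (r - 1)" and v: "1 \<le> v" "v \<le> n + r"
  shows "measure_pmf.expectation (random_hypergraph r n p) (\<lambda>H. w ^ greedy_intervals r n H v)
    \<le> z ^ (n + r - v)"
  using v
proof (induction "n + r - v" arbitrary: v rule: less_induct)
  case less
  let ?E = "measure_pmf.expectation (random_hypergraph r n p)"
  let ?G = "greedy_intervals r n"
  show ?case
  proof (cases "n < v")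
    case True
    then show ?thesis
      using z by (simp add: greedy_intervals_beyond)
  next
    case False
    let ?e = "{v..<v + r}"
    let ?hit = "indicator {H. ?e \<in> H} :: nat set set \<Rightarrow> real"
    let ?miss = "indicator {H. ?e \<notin> H} :: nat set set \<Rightarrow> real"
    have r0: "r > 0" using r by simp
    \<comment> \<open>The tested interval contains \<open>v\<close>, which lies to the left of every
      vertex where the scan can resume, so the rest of the scan never looks at it.\<close>
    have e: "\<exists>x\<in>e. x < u" if "e \<in> {?e}" "v < u" for e u
      using that r0 by auto
    \<comment> \<open>Intervals sticking out beyond \<open>n\<close> are never edges, so the hit
      probability is 0 there instead of \<open>p\<close>; the one-step inequality then reduces to
      \<open>z ^ (r - 2) \<le> z ^ (r - 1)\<close>.\<close>
    define \<pi> where "\<pi> = ?E ?hit"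
    have \<pi>: "\<pi> = p \<or> \<pi> = 0"
      using prob_random_hypergraph_edge[of ?e r n p] prob_random_hypergraph_non_edge[of ?e r n p] p
      unfolding \<pi>_def by (cases "?e \<in> potential_edges r n") auto
    have miss: "?E ?miss = 1 - \<pi>"
    proof -
      have "?miss = (\<lambda>H. 1 - ?hit H)"
        by (auto simp: indicator_def)
      then show ?thesis
        by (simp add: \<pi>_def)
    qed
    have "?E (\<lambda>H. w ^ ?G H v) = ?E (\<lambda>H. ?hit H * (w * w ^ ?G H (v + r - 1)) + ?miss H * w ^ ?G H (Suc v))"
      using False greedy_intervals_hit[OF r] greedy_intervals_miss
      by (intro Bochner_Integration.integral_cong refl) (simp add: indicator_def)
    also have "\<dots> = ?E (\<lambda>H. ?hit H * (w * w ^ ?G H (v + r - 1))) + ?E (\<lambda>H. ?miss H * w ^ ?G H (Suc v))"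
      by simp
    also have "?E (\<lambda>H. ?hit H * (w * w ^ ?G H (v + r - 1))) = \<pi> * (w * ?E (\<lambda>H. w ^ ?G H (v + r - 1)))"
    proof -
      have "v < v + r - 1"
        using r by simp
      then have D: "?G (H - {?e}) (v + r - 1) = ?G H (v + r - 1)" for H
        by (intro greedy_intervals_Diff e)
      show ?thesis
        by (subst expectation_random_hypergraph_mult[where A = "{?e}"])
          (simp_all add: D \<pi>_def indicator_def del: One_nat_def)
    qed
    also have "?E (\<lambda>H. ?miss H * w ^ ?G H (Suc v)) = (1 - \<pi>) * ?E (\<lambda>H. w ^ ?G H (Suc v))"
    proof -
      have D: "?G (H - {?e}) (Suc v) = ?G H (Suc v)" for H
        by (intro greedy_intervals_Diff e lessI)
      have "?E (\<lambda>H. ?miss H * w ^ ?G H (Suc v)) = ?E ?miss * ?E (\<lambda>H. w ^ ?G H (Suc v))"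
        by (rule expectation_random_hypergraph_mult[where A = "{?e}"]) (simp_all add: D indicator_def)
      then show ?thesis
        by (simp only: miss)
    qed
    also have "\<pi> * (w * ?E (\<lambda>H. w ^ ?G H (v + r - 1))) + (1 - \<pi>) * ?E (\<lambda>H. w ^ ?G H (Suc v))
      \<le> \<pi> * (w * z ^ (n + r - (v + r - 1))) + (1 - \<pi>) * z ^ (n + r - Suc v)"
    proof -
      have "?E (\<lambda>H. w ^ ?G H (v + r - 1)) \<le> z ^ (n + r - (v + r - 1))"
        using False r less.prems by (intro less(1)) auto
      moreover have "?E (\<lambda>H. w ^ ?G H (Suc v)) \<le> z ^ (n + r - Suc v)"
        using False r less.prems by (intro less(1)) auto
      moreover have "0 \<le> \<pi>" "\<pi> \<le> 1"
        using \<pi> p by auto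
      ultimately show ?thesis
        using w by (intro add_mono mult_left_mono) auto
    qed
    also have "\<dots> = z ^ (n + 1 - v) * (\<pi> * w + (1 - \<pi>) * z ^ (r - 2))"
    proof -
      have "n + r - (v + r - 1) = n + 1 - v" "n + r - Suc v = (n + 1 - v) + (r - 2)"
        using r False by auto
      then show ?thesis
        by (simp add: algebra_simps power_add)
    qed
    also have "\<dots> \<le> z ^ (n + 1 - v) * z ^ (r - 1)"
    proof (intro mult_left_mono)
      show "\<pi> * w + (1 - \<pi>) * z ^ (r - 2) \<le> z ^ (r - 1)"
        using \<pi> wz power_increasing[of "r - 2" "r - 1" z] z by auto
    qed (use z in auto)
    also have "\<dots> = z ^ (n + r - v)"
      using r False by (simp flip: power_add)
    finally show ?thesis .
  qed
qed

subsection \<open>The greedy path\<close>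

definition edges_from :: "nat \<Rightarrow> nat \<Rightarrow> nat \<Rightarrow> nat set set" where
  "edges_from r v u = {e. card e = r \<and> v \<in> e \<and> e \<subseteq> {v..u}}"

lemma edges_from_mono: "u \<le> u' \<Longrightarrow> edges_from r v u \<subseteq> edges_from r v u'"
  by (auto simp: edges_from_def)

lemma edges_from_subset: "1 \<le> v \<Longrightarrow> u \<le> n \<Longrightarrow> edges_from r v u \<subseteq> potential_edges r n"
  by (auto simp: edges_from_def potential_edges_def)

lemma edges_from_eq_empty:
  assumes "u < v + r - 1"
  shows "edges_from r v u = {}"
proof -
  have "card e < r" if "v \<in> e" "e \<subseteq> {v..u}" for e
    using card_mono[OF _ that(2)] assms that by auto
  then show ?thesis
    by (auto simp: edges_from_def)
qed

lemma card_edges_from: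
  assumes "r \<ge> 1" "v \<le> u"
  shows "card (edges_from r v u) = (u - v) choose (r - 1)"
proof -
  let ?S = "{S. S \<subseteq> {v<..u} \<and> card S = r - 1}"
  have "edges_from r v u = insert v ` ?S"
  proof (intro equalityI subsetI)
    fix e assume e: "e \<in> edges_from r v u"
    then have "e = insert v (e - {v})" "e - {v} \<in> ?S"
      by (auto simp: edges_from_def)
    then show "e \<in> insert v ` ?S"
      by blast
  next
    fix e assume "e \<in> insert v ` ?S"
    then obtain S where S: "e = insert v S" "S \<subseteq> {v<..u}" "card S = r - 1"
      by blast
    then have "finite S" "v \<notin> S"
      using finite_subset by auto
    then show "e \<in> edges_from r v u"
      using S assms by (auto simp: edges_from_def)
  qed
  moreover have "inj_on (insert v) ?S"
  proof (rule inj_onI)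
    fix S T assume "S \<in> ?S" "T \<in> ?S" "insert v S = insert v T"
    moreover from this have "v \<notin> S" "v \<notin> T"
      by auto
    ultimately show "S = T"
      by (metis Diff_insert_absorb)
  qed
  ultimately show ?thesis
    by (simp add: card_image n_subsets)
qed

text \<open>The value \<open>Suc n\<close> encodes that no edge has first vertex \<open>v\<close>.\<close>

definition next_end :: "nat \<Rightarrow> nat \<Rightarrow> nat set set \<Rightarrow> nat \<Rightarrow> nat" where
  "next_end r n H v = (LEAST u. n < u \<or> H \<inter> edges_from r v u \<noteq> {})"

lemma next_end_le: "next_end r n H v \<le> Suc n"
  unfolding next_end_def by (rule Least_le) simp

text \<open>Turns a tail event of the next end into the absence of a fixed set of edges, whose
  probability is a power of \<open>1 - p\<close>.\<close>

lemma less_next_end_iff: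
  assumes "u \<le> n"
  shows "u < next_end r n H v \<longleftrightarrow> H \<inter> edges_from r v u = {}"
proof
  show "u < next_end r n H v \<Longrightarrow> H \<inter> edges_from r v u = {}"
    unfolding next_end_def using not_less_Least by blast
next
  assume empty: "H \<inter> edges_from r v u = {}"
  have "n < next_end r n H v \<or> H \<inter> edges_from r v (next_end r n H v) \<noteq> {}"
    unfolding next_end_def by (rule LeastI[of _ "Suc n"]) simp
  then show "u < next_end r n H v"
    using empty assms edges_from_mono[of "next_end r n H v" u r v] by (meson disjoint_iff leI order_le_less_trans subsetD)
qed

text \<open>By minimality: an edge inside \<open>{v..u}\<close> that missed the least such
  \<open>u\<close> would already lie inside \<open>{v..u - 1}\<close>.\<close>

lemma next_end_edge:
  assumes "next_end r n H v \<le> n"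
  obtains e where "e \<in> H" "e \<in> edges_from r v (next_end r n H v)" "next_end r n H v \<in> e"
proof -
  let ?u = "next_end r n H v"
  obtain e where e: "e \<in> H" "e \<in> edges_from r v ?u"
    using less_next_end_iff[OF assms, of r H v] by blast
  have "?u \<in> e"
  proof (rule ccontr)
    assume "?u \<notin> e"
    then have sub: "e \<subseteq> {v..<?u}"
      using e(2) by (force simp: edges_from_def le_less)
    then have "?u \<noteq> 0"
      using e(2) by (auto simp: edges_from_def)
    then have "e \<in> edges_from r v (?u - 1)"
      using e(2) sub by (force simp: edges_from_def)
    moreover have "?u - 1 < ?u" "?u - 1 \<le> n"
      using \<open>?u \<noteq> 0\<close> assms by auto
    ultimately show False
      using e(1) less_next_end_iff[of "?u - 1" n r H v] by blast
  qed
  then show thesis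
    using e that by blast
qed

lemma next_end_gt:
  assumes "r \<ge> 2" "v \<le> n"
  shows "v < next_end r n H v"
  using assms by (simp add: less_next_end_iff edges_from_eq_empty)

text \<open>The guard \<open>v < next_end r n H v\<close> secures termination for every
  \<open>r\<close>: for \<open>r = 1\<close> an edge \<open>{v}\<close> would make \<open>v\<close>
  its own next end.\<close>

function greedy_length :: "nat \<Rightarrow> nat \<Rightarrow> nat set set \<Rightarrow> nat \<Rightarrow> nat" where
  "greedy_length r n H v =
     (if v < next_end r n H v \<and> next_end r n H v \<le> n
      then Suc (greedy_length r n H (next_end r n H v)) else 0)"
  by auto
termination
  by (relation "Wellfounded.measure (\<lambda>(r, n, H, v). n - v)") auto

declare greedy_length.simps [simp del]

lemma greedy_length_step:
  assumes "r \<ge> 2" "v \<le> n" "next_end r n H v \<le> n"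
  shows "greedy_length r n H v = Suc (greedy_length r n H (next_end r n H v))"
  using assms by (subst greedy_length.simps) (simp add: next_end_gt)

lemma greedy_length_stop: "n < next_end r n H v \<Longrightarrow> greedy_length r n H v = 0"
  by (subst greedy_length.simps) simp

lemma next_end_Int:
  assumes "\<And>u. edges_from r v u \<subseteq> A"
  shows "next_end r n (H \<inter> A) v = next_end r n H v"
proof -
  have "H \<inter> A \<inter> edges_from r v u = H \<inter> edges_from r v u" for u
    using assms[of u] by blast
  then show ?thesis
    by (simp add: next_end_def)
qed

text \<open>From \<open>u\<close> on, the greedy path examines only edges whose first vertex is at
  least \<open>u\<close>, and none of these contains the smaller vertex \<open>v\<close>.\<close>

lemma greedy_length_Diff:
  assumes "v < u"
  shows "greedy_length r n (H - {e. v \<in> e}) u = greedy_length r n H u"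
  using assms
proof (induction "n - u" arbitrary: u rule: less_induct)
  case less
  have "next_end r n (H - {e. v \<in> e}) u = next_end r n H u"
    unfolding Diff_eq by (rule next_end_Int) (use less.prems in \<open>auto simp: edges_from_def\<close>)
  moreover have "greedy_length r n (H - {e. v \<in> e}) (next_end r n H u) = greedy_length r n H (next_end r n H u)"
    if "u < next_end r n H u \<and> next_end r n H u \<le> n"
    using that less.prems by (intro less.hyps diff_less_mono2) auto
  ultimately show ?case
    unfolding greedy_length.simps[of r n "H - {e. v \<in> e}" u] greedy_length.simps[of r n H u]
    by presburger
qed

text \<open>The edge has minimum \<open>v\<close> and maximum \<open>w 1\<close>, so its sorted
  vertices can be placed in front of the path, glued at \<open>w 1\<close>.\<close>

lemma ordered_loose_path_Cons:
  assumes r: "r \<ge> 2" and path: "ordered_loose_path r n H l w" and v: "1 \<le> v"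
    and e: "e \<in> H" "e \<in> edges_from r v (w 1)" "w 1 \<in> e"
  shows "\<exists>w'. ordered_loose_path r n H (Suc l) w' \<and> w' 1 = v"
proof -
  define d where "d = r - 1"
  have d: "r = Suc d" "d \<ge> 1"
    using r by (auto simp: d_def)
  define xs where "xs = sorted_list_of_set e"
  have e': "finite e" "card e = r" "v \<in> e" "e \<subseteq> {v..w 1}"
    using e(2) finite_subset by (auto simp: edges_from_def)
  have xs: "length xs = r" "set xs = e" and
    xs_less: "\<And>i j. i < j \<Longrightarrow> j < r \<Longrightarrow> xs ! i < xs ! j"
    using e' by (auto simp: xs_def intro: sorted_wrt_nth_less)
  have xs_in: "xs ! i \<in> e" if "i < r" for i
    using that xs nth_mem by blast
  obtain a where a: "a < r" "xs ! a = w 1"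
    using e(3) xs by (metis in_set_conv_nth)
  have "a = d"
  proof (rule ccontr)
    assume "a \<noteq> d"
    then have "w 1 < xs ! d"
      using xs_less[of a d] a d by auto
    then show False
      using xs_in[of d] e'(4) d by fastforce
  qed
  then have last: "xs ! d = w 1"
    using a by simp
  obtain b where b: "b < r" "xs ! b = v"
    using e'(3) xs by (metis in_set_conv_nth)
  have "b = 0"
  proof (rule ccontr)
    assume "b \<noteq> 0"
    then have "xs ! 0 < v"
      using xs_less[of 0 b] b by auto
    then show False
      using xs_in[of 0] e'(4) d by fastforce
  qed
  then have first: "xs ! 0 = v"
    using b by simp
  define w' where "w' i = (if i \<le> d then xs ! (i - 1) else w (i - d))" for i
  \<comment> \<open>The two pieces of \<open>w'\<close> agree at the joint index
    \<open>Suc d\<close>, where the last vertex of the new edge is \<open>w 1\<close>.\<close>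
  have w'_xs: "w' i = xs ! (i - 1)" if "1 \<le> i" "i \<le> Suc d" for i
    using that last by (cases "i = Suc d") (auto simp: w'_def)
  have w'_w: "w' (i + d) = w i" if "1 \<le> i" for i
    using that by (simp add: w'_def)
  have sm: "strict_mono_on {1..l * d + 1} w" and in_n: "w ` {1..l * d + 1} \<subseteq> {1..n}"
    and edges: "\<And>k. k \<in> {1..l} \<Longrightarrow> w ` {(k - 1) * d + 1..k * d + 1} \<in> H"
    using path by (auto simp: ordered_loose_path_def d)
  have w1: "w 1 \<le> w i" if "i \<in> {1..l * d + 1}" for i
    using strict_mono_on_leD[OF sm, of 1 i] that by simp
  have e_in: "e \<subseteq> {1..n}"
    using e'(4) v in_n by fastforce
  have "strict_mono_on {1..Suc l * d + 1} w'"
  proof (rule strict_mono_onI)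
    fix i j assume ij: "i \<in> {1..Suc l * d + 1}" "j \<in> {1..Suc l * d + 1}" "i < j"
    show "w' i < w' j"
    proof (cases "j \<le> Suc d")
      case True
      then show ?thesis
        using ij d xs_less[of "i - 1" "j - 1"] by (auto simp: w'_xs)
    next
      case False
      then have j: "w' j = w (j - d)" "j - d \<in> {1..l * d + 1}"
        using ij by (auto simp: w'_def)
      show ?thesis
      proof (cases "i \<le> d")
        case True
        then have "w' i < w 1"
          using ij d xs_less[of "i - 1" d] last by (auto simp: w'_xs)
        then show ?thesis
          using w1[OF j(2)] j(1) by simp
      next
        case i: False
        then have "w' i = w (i - d)" "i - d \<in> {1..l * d + 1}"
          using ij by (auto simp: w'_def)
        then show ?thesis
          using strict_mono_onD[OF sm, of "i - d" "j - d"] j i ij by simp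
      qed
    qed
  qed
  moreover have "w' i \<in> {1..n}" if "i \<in> {1..Suc l * d + 1}" for i
  proof (cases "i \<le> d")
    case True
    then show ?thesis
      using that subsetD[OF e_in xs_in[of "i - 1"]] d by (simp add: w'_xs)
  next
    case False
    then have "w' i = w (i - d)" "i - d \<in> {1..l * d + 1}"
      using that by (auto simp: w'_def)
    then show ?thesis
      using in_n by blast
  qed
  moreover have "w' ` {(k - 1) * d + 1..k * d + 1} \<in> H" if "k \<in> {1..Suc l}" for k
  proof (cases "k = 1")
    case True
    have "w' ` {1..r} = (\<lambda>i. w' (Suc i)) ` {0..<r}"
      by (metis (no_types) One_nat_def atLeastLessThanSuc_atLeastAtMost image_Suc_atLeastLessThan image_image)
    also have "\<dots> = (\<lambda>i. xs ! i) ` {0..<r}"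
      using d by (intro image_cong) (auto simp: w'_xs)
    also have "\<dots> = e"
      using xs by (metis list.set_map map_nth set_upt)
    finally show ?thesis
      using True e d by simp
  next
    case False
    define m where "m = k - 1"
    have m: "k = Suc m" "m \<in> {1..l}"
      using that False by (auto simp: m_def)
    have "{(k - 1) * d + 1..k * d + 1} = (\<lambda>i. i + d) ` {(m - 1) * d + 1..m * d + 1}"
      unfolding image_add_atLeastAtMost' using m by (cases m) (auto simp: algebra_simps)
    then have "w' ` {(k - 1) * d + 1..k * d + 1} = (\<lambda>i. w' (i + d)) ` {(m - 1) * d + 1..m * d + 1}"
      by (simp only: image_image)
    also have "\<dots> = w ` {(m - 1) * d + 1..m * d + 1}"
      by (intro image_cong refl w'_w) simp
    finally have "w' ` {(k - 1) * d + 1..k * d + 1} = w ` {(m - 1) * d + 1..m * d + 1}" .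
    then show ?thesis
      using edges[OF m(2)] by simp
  qed
  moreover have "w' 1 = v"
    using first by (simp add: w'_xs)
  ultimately show ?thesis
    by (auto simp: ordered_loose_path_def d)
qed

lemma greedy_length_path:
  assumes "r \<ge> 2" "1 \<le> v" "v \<le> n"
  shows "\<exists>w. ordered_loose_path r n H (greedy_length r n H v) w \<and> w 1 = v"
  using assms(2,3)
proof (induction "n - v" arbitrary: v rule: less_induct)
  case less
  let ?u = "next_end r n H v"
  show ?case
  proof (cases "?u \<le> n")
    case True
    have "v < ?u"
      using assms(1) less.prems by (simp add: next_end_gt)
    then obtain w where "ordered_loose_path r n H (greedy_length r n H ?u) w" "w 1 = ?u"
      using less.hyps[of ?u] less.prems True diff_less_mono2[of v ?u n] by auto
    moreover obtain e where "e \<in> H" "e \<in> edges_from r v ?u" "?u \<in> e"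
      using next_end_edge[OF True] by blast
    ultimately show ?thesis
      using ordered_loose_path_Cons[OF assms(1), of n H _ w v e] less.prems True assms(1)
      by (simp add: greedy_length_step)
  next
    case False
    then have "ordered_loose_path r n H (greedy_length r n H v) (\<lambda>_. v)"
      using less.prems by (auto simp: greedy_length_stop ordered_loose_path_def strict_mono_on_def)
    then show ?thesis
      by blast
  qed
qed

lemma greedy_length_le_max_path_length:
  assumes "r \<ge> 2" "1 \<le> n"
  shows "greedy_length r n H 1 \<le> max_path_length r n H"
  unfolding max_path_length_def
  using greedy_length_path[of r 1 n H] assms finite_path_lengths[OF assms(1)] by (intro Max_ge) auto

subsection \<open>Exponential moments of the greedy path\<close>

text \<open>Binomial coefficients increase up to the middle, so \<open>choose 1\<close> is at most
  \<open>choose d\<close> for \<open>d \<le> i\<close>; otherwise symmetry replaces \<open>d\<close>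
  by \<open>i\<close>. It makes the exponents in the next sum linear.\<close>

lemma add_le_binomial:
  assumes "d \<ge> 1" "i \<ge> 1"
  shows "d + i \<le> (d + i) choose d"
proof -
  have "(d + i) choose 1 \<le> (d + i) choose d"
  proof (cases "d \<le> i")
    case True
    then show ?thesis
      using assms by (intro binomial_mono) auto
  next
    case False
    then have "(d + i) choose 1 \<le> (d + i) choose i"
      using assms by (intro binomial_mono) auto
    then show ?thesis
      using binomial_symmetric[of d "d + i"] by simp
  qed
  then show ?thesis
    by simp
qed

text \<open>The term \<open>i = 0\<close> has exponent 1 and is kept exactly; the others are
  dominated by a geometric series. At \<open>z = 1\<close> and \<open>q = 1 - p\<close> the bound
  becomes \<open>q + q ^ Suc d / p\<close>, the mean excess advance.\<close>

lemma sum_power_binomial_le: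
  fixes q z :: real
  assumes "d \<ge> 1" "0 \<le> q" "q \<le> 1" "0 \<le> z" "q * z < 1"
  shows "(\<Sum>i<m. z ^ i * q ^ ((d + i) choose d)) \<le> q + z * q ^ Suc d / (1 - q * z)"
proof (cases m)
  case (Suc k)
  have "(\<Sum>i<m. z ^ i * q ^ ((d + i) choose d)) = q + (\<Sum>i<k. z ^ Suc i * q ^ ((d + Suc i) choose d))"
    unfolding Suc sum.lessThan_Suc_shift by simp
  also have "(\<Sum>i<k. z ^ Suc i * q ^ ((d + Suc i) choose d)) \<le> (\<Sum>i<k. z ^ Suc i * q ^ (d + Suc i))"
    using assms by (intro sum_mono mult_left_mono power_decreasing add_le_binomial) auto
  also have "\<dots> = z * q ^ Suc d * (\<Sum>i<k. (q * z) ^ i)"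
    by (simp add: sum_distrib_left power_mult_distrib power_add mult_ac)
  also have "(\<Sum>i<k. (q * z) ^ i) \<le> 1 / (1 - q * z)"
    using assms by (simp add: sum_gp_strict divide_right_mono)
  finally show ?thesis
    using assms by (simp add: mult_left_mono)
qed (use assms in auto)

text \<open>Summation by parts: the power is written through the tail probabilities of the next end,
  each of which is \<open>1 - p\<close> to the number of potential edges that must be
  absent.\<close>

lemma expectation_power_next_end_le:
  fixes p z :: real
  assumes r: "r \<ge> 2" and p: "0 \<le> p" "p \<le> 1" and z: "1 \<le> z" "(1 - p) * z < 1" and v: "1 \<le> v" "v \<le> n"
  shows "measure_pmf.expectation (random_hypergraph r n p) (\<lambda>H. z ^ next_end r n H v)
    \<le> z ^ v * (z ^ (r - 1) * (1 + (z - 1) * (1 - p + z * (1 - p) ^ r / (1 - (1 - p) * z))))"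
proof -
  let ?E = "measure_pmf.expectation (random_hypergraph r n p)"
  define q where "q = 1 - p"
  define d where "d = r - 1"
  define a where "a = v + d"
  have d: "r = Suc d" "d \<ge> 1"
    using r by (auto simp: d_def)
  let ?gt = "\<lambda>u. indicator {H. u < next_end r n H v} :: nat set set \<Rightarrow> real"
  \<comment> \<open>Telescoping starts at \<open>a\<close>, the earliest end of an edge with first
    vertex \<open>v\<close>. A next end below \<open>a\<close> can only be the value
    \<open>Suc n\<close>, when \<open>v\<close> is close to \<open>n\<close>; this is why an
    inequality is stated.\<close>
  have "z ^ next_end r n H v \<le> z ^ a + (\<Sum>u\<in>{a..<Suc n}. (z ^ Suc u - z ^ u) * ?gt u H)" for H
  proof (cases "next_end r n H v \<le> a")
    case True
    have "0 \<le> (\<Sum>u\<in>{a..<Suc n}. (z ^ Suc u - z ^ u) * ?gt u H)"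
      using z by (intro sum_nonneg mult_nonneg_nonneg) (auto simp: mult_le_cancel_right1)
    moreover have "z ^ next_end r n H v \<le> z ^ a"
      using True z by (intro power_increasing)
    ultimately show ?thesis
      by linarith
  next
    case False
    let ?N = "next_end r n H v"
    have "z ^ ?N - z ^ a = (\<Sum>u\<in>{a..<?N}. z ^ Suc u - z ^ u)"
      using False by (subst sum_Suc_diff') auto
    also have "\<dots> = (\<Sum>u\<in>{a..<?N}. (z ^ Suc u - z ^ u) * ?gt u H)"
      by (intro sum.cong) auto
    also have "\<dots> \<le> (\<Sum>u\<in>{a..<Suc n}. (z ^ Suc u - z ^ u) * ?gt u H)"
      using next_end_le[of r n H v] z
      by (intro sum_mono2 mult_nonneg_nonneg) (auto simp: mult_le_cancel_right1)
    finally show ?thesis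
      by linarith
  qed
  then have "?E (\<lambda>H. z ^ next_end r n H v) \<le>
      ?E (\<lambda>H. z ^ a + (\<Sum>u\<in>{a..<Suc n}. (z ^ Suc u - z ^ u) * ?gt u H))"
    by (intro integral_mono) auto
  also have "\<dots> = z ^ a + (\<Sum>u\<in>{a..<Suc n}. (z ^ Suc u - z ^ u) * ?E (?gt u))"
    by (simp only: Bochner_Integration.integral_add Bochner_Integration.integral_sum
        integrable_random_hypergraph integral_mult_right_zero) simp
  also have "(\<Sum>u\<in>{a..<Suc n}. (z ^ Suc u - z ^ u) * ?E (?gt u))
      = (\<Sum>u\<in>{a..<Suc n}. (z ^ Suc u - z ^ u) * q ^ ((u - v) choose d))"
  proof (intro sum.cong refl)
    fix u assume u: "u \<in> {a..<Suc n}"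
    then have "{H. u < next_end r n H v} = {H. H \<inter> edges_from r v u = {}}"
      by (simp add: less_next_end_iff)
    then have "?E (?gt u) = q ^ card (edges_from r v u)"
      using prob_random_hypergraph_no_edges[OF edges_from_subset p, of v u n r] u v by (simp add: q_def)
    moreover have "v \<le> u"
      using u by (simp add: a_def)
    ultimately show "(z ^ Suc u - z ^ u) * ?E (?gt u) = (z ^ Suc u - z ^ u) * q ^ ((u - v) choose d)"
      using r by (simp add: card_edges_from d_def)
  qed
  also have "\<dots> = (\<Sum>i<Suc n - a. (z ^ Suc (i + a) - z ^ (i + a)) * q ^ ((i + a - v) choose d))"
    by (rule sum.reindex_bij_witness[of _ "\<lambda>i. i + a" "\<lambda>u. u - a"]) auto
  also have "\<dots> = z ^ a * (z - 1) * (\<Sum>i<Suc n - a. z ^ i * q ^ ((d + i) choose d))"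
    by (simp add: sum_distrib_left a_def power_add algebra_simps)
  also have "z ^ a + z ^ a * (z - 1) * (\<Sum>i<Suc n - a. z ^ i * q ^ ((d + i) choose d)) \<le>
      z ^ a + z ^ a * (z - 1) * (q + z * q ^ Suc d / (1 - q * z))"
    using p z d by (intro add_left_mono mult_left_mono sum_power_binomial_le) (auto simp: q_def)
  also have "\<dots> = z ^ v * (z ^ d * (1 + (z - 1) * (q + z * q ^ r / (1 - q * z))))"
    by (simp only: a_def power_add d(1)) (simp only: distrib_left mult_ac mult_1_right)
  finally show ?thesis
    by (simp only: q_def d_def)
qed

text \<open>Backward induction on \<open>v\<close>, conditioning on the next end. The hypothesis
  \<open>yz\<close> makes one step of the path, with weight \<open>y\<close>, compensate the growth
  of \<open>z\<close> to the power of the position. The bound is normalised so that \<open>y\<close>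
  times its value at \<open>Suc n\<close> is 1, the contribution of a stopped path.\<close>

lemma expectation_greedy_length_le:
  fixes p y z :: real
  assumes r: "r \<ge> 2" and p: "0 \<le> p" "p \<le> 1" and z: "1 \<le> z" "(1 - p) * z < 1" and y: "0 < y"
    and yz: "y * (z ^ (r - 1) * (1 + (z - 1) * (1 - p + z * (1 - p) ^ r / (1 - (1 - p) * z)))) \<le> 1"
    and v: "1 \<le> v" "v \<le> n"
  shows "measure_pmf.expectation (random_hypergraph r n p) (\<lambda>H. y ^ greedy_length r n H v)
    \<le> z ^ v / (y * z ^ Suc n)"
  using v
proof (induction "n - v" arbitrary: v rule: less_induct)
  case less
  let ?E = "measure_pmf.expectation (random_hypergraph r n p)"
  let ?T = "greedy_length r n"
  let ?N = "next_end r n"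
  let ?eq = "\<lambda>u. indicator {H. ?N H v = u} :: nat set set \<Rightarrow> real"
  have N_in: "?N H v \<in> {v<..Suc n}" for H
    using next_end_gt[OF r less.prems(2)] next_end_le by simp
  have sum_eq: "(\<Sum>u\<in>{v<..Suc n}. ?eq u H * f u) = f (?N H v)" for f :: "nat \<Rightarrow> real" and H
  proof -
    have "(\<Sum>u\<in>{v<..Suc n}. ?eq u H * f u) = (\<Sum>u\<in>{v<..Suc n}. if u = ?N H v then f u else 0)"
      by (intro sum.cong) auto
    then show ?thesis
      using N_in[of H] by simp
  qed
  \<comment> \<open>The value 1 at \<open>u = Suc n\<close> is the case in which no further edge
    exists and the greedy length is 0.\<close>
  let ?S = "\<lambda>u H. if u \<le> n then y * y ^ ?T H u else 1"
  have "?E (\<lambda>H. y ^ ?T H v) = ?E (\<lambda>H. \<Sum>u\<in>{v<..Suc n}. ?eq u H * ?S u H)"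
    unfolding sum_eq using r less.prems
    by (intro Bochner_Integration.integral_cong refl) (simp add: greedy_length_step greedy_length_stop)
  also have "\<dots> = (\<Sum>u\<in>{v<..Suc n}. ?E (\<lambda>H. ?eq u H * ?S u H))"
    by (intro Bochner_Integration.integral_sum) simp
  \<comment> \<open>The next end depends only on edges containing \<open>v\<close>, the continuation
    beyond it only on edges avoiding \<open>v\<close>.\<close>
  also have "\<dots> = (\<Sum>u\<in>{v<..Suc n}. ?E (?eq u) * ?E (?S u))"
  proof (intro sum.cong refl expectation_random_hypergraph_mult[where A = "{e. v \<in> e}"])
    fix u H
    have "?N (H \<inter> {e. v \<in> e}) v = ?N H v"
      by (rule next_end_Int) (auto simp: edges_from_def)
    then show "?eq u (H \<inter> {e. v \<in> e}) = ?eq u H"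
      by (simp add: indicator_def)
  next
    fix u H assume "u \<in> {v<..Suc n}"
    then show "?S u (H - {e. v \<in> e}) = ?S u H"
      by (simp add: greedy_length_Diff)
  qed
  also have "\<dots> \<le> (\<Sum>u\<in>{v<..Suc n}. ?E (?eq u) * (z ^ u / z ^ Suc n))"
  proof (intro sum_mono mult_left_mono)
    fix u assume u: "u \<in> {v<..Suc n}"
    show "?E (?S u) \<le> z ^ u / z ^ Suc n"
    proof (cases "u \<le> n")
      case True
      then have "?E (\<lambda>H. y ^ ?T H u) \<le> z ^ u / (y * z ^ Suc n)"
        using u less.prems by (intro less.hyps diff_less_mono2) auto
      then have "y * ?E (\<lambda>H. y ^ ?T H u) \<le> y * (z ^ u / (y * z ^ Suc n))"
        using y by (intro mult_left_mono) auto
      then show ?thesis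
        using True y by simp
    next
      case False
      then have "u = Suc n"
        using u by simp
      then show ?thesis
        using z by simp
    qed
  qed simp
  also have "\<dots> = ?E (\<lambda>H. \<Sum>u\<in>{v<..Suc n}. ?eq u H * z ^ u) / z ^ Suc n"
    by (simp only: Bochner_Integration.integral_sum integrable_random_hypergraph
        integral_mult_left_zero times_divide_eq_right sum_divide_distrib)
  also have "\<dots> = ?E (\<lambda>H. z ^ ?N H v) / z ^ Suc n"
    unfolding sum_eq ..
  also have "\<dots> \<le> z ^ v * (1 / y) / z ^ Suc n"
  proof (intro divide_right_mono)
    let ?M = "z ^ (r - 1) * (1 + (z - 1) * (1 - p + z * (1 - p) ^ r / (1 - (1 - p) * z)))"
    have "?M \<le> 1 / y"
      using yz y by (simp add: field_simps)
    then have "z ^ v * ?M \<le> z ^ v * (1 / y)"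
      using z by (intro mult_left_mono) auto
    then show "?E (\<lambda>H. z ^ ?N H v) \<le> z ^ v * (1 / y)"
      using expectation_power_next_end_le[OF r p z less.prems] by linarith
  qed (use z in simp)
  finally show ?case
    by simp
qed

subsection \<open>Tail bounds\<close>

lemma prob_random_hypergraph_Markov:
  fixes f :: "nat set set \<Rightarrow> real"
  assumes "0 < c" "\<And>H. 0 \<le> f H" "\<And>H. H \<in> S \<Longrightarrow> c \<le> f H"
  shows "measure_pmf.prob (random_hypergraph r n p) S \<le>
    measure_pmf.expectation (random_hypergraph r n p) f / c"
proof -
  have "measure_pmf.expectation (random_hypergraph r n p) (indicator S) \<le>
      measure_pmf.expectation (random_hypergraph r n p) (\<lambda>H. f H / c)"
    using assms by (intro integral_mono) (auto simp: indicator_def field_simps)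
  then show ?thesis
    by simp
qed

text \<open>The inequality \<open>1 - t \<le> exp (- t)\<close> at \<open>t = x / (1 + x)\<close>
  gives the case \<open>b = x\<close>. It reverses the usual linear bound on \<open>exp\<close> at
  the cost of a factor \<open>1 + b\<close>.\<close>

lemma exp_divide_le_add_one:
  fixes x b :: real
  assumes "0 \<le> x" "x \<le> b"
  shows "exp (x / (1 + b)) \<le> 1 + x"
proof -
  have "exp (x / (1 + b)) \<le> exp (x / (1 + x))"
    unfolding exp_le_cancel_iff using assms by (intro frac_le) auto
  also have "\<dots> \<le> 1 + x"
  proof -
    have "1 / (1 + x) \<le> exp (- (x / (1 + x)))"
      using exp_ge_add_one_self[of "- (x / (1 + x))"] assms by (simp add: field_simps)
    then show ?thesis
      using assms by (simp add: exp_minus field_simps)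
  qed
  finally show ?thesis .
qed

text \<open>Markov's inequality for the exponential moment of the interval count. The constants are
  chosen before \<open>n\<close> and \<open>p\<close>, so the bound is uniform in
  \<open>p \<ge> c\<close>.\<close>

lemma max_path_length_upper_tail:
  fixes c \<epsilon> :: real
  assumes r: "r \<ge> 2" and c: "0 < c" and \<epsilon>: "0 < \<epsilon>"
  shows "\<exists>C \<gamma>. 0 < \<gamma> \<and> (\<forall>n p. c \<le> p \<longrightarrow> p \<le> 1 \<longrightarrow> 1 \<le> n \<longrightarrow>
    measure_pmf.prob (random_hypergraph r n p)
      {H. (1 + \<epsilon>) * real n * (1 / real r + 1 / (real r * (real r - 2 + 1 / p))) < real (max_path_length r n H)}
      \<le> C * exp (- \<gamma> * real n))"
proof -
  \<comment> \<open>With this choice \<open>\<theta> / p \<le> \<epsilon> / 2\<close> for every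
    \<open>p \<ge> c\<close>, so the loss in passing from linear to exponential is at most
    \<open>1 + \<epsilon> / 2\<close>. Dividing \<open>1 + \<epsilon>\<close> by this loss leaves
    \<open>\<theta> + \<gamma>\<close> in the exponent.\<close>
  define \<theta> where "\<theta> = c * \<epsilon> / 2"
  define \<gamma> where "\<gamma> = \<theta> * (\<epsilon> / 2) / (1 + \<epsilon> / 2)"
  define z where "z = exp \<theta>"
  have \<theta>: "0 < \<theta>"
    using c \<epsilon> by (simp add: \<theta>_def)
  then have "0 < \<gamma>"
    using \<epsilon> by (simp add: \<gamma>_def)
  moreover have "measure_pmf.prob (random_hypergraph r n p)
      {H. (1 + \<epsilon>) * real n * (1 / real r + 1 / (real r * (real r - 2 + 1 / p))) < real (max_path_length r n H)}
      \<le> exp (\<theta> * (real r - 1)) * exp (- \<gamma> * real n)"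
    if p: "c \<le> p" "p \<le> 1" and n: "1 \<le> n" for n :: nat and p :: real
  proof -
    have p0: "0 < p"
      using c p by linarith
    define m where "m = real r - 2 + 1 / p"
    have m: "0 < m"
      using r p0 by (simp add: m_def add_nonneg_pos)
    define \<mu> where "\<mu> = \<theta> * m / (1 + \<epsilon> / 2)"
    have \<mu>: "0 < \<mu>"
      using \<theta> m \<epsilon> by (simp add: \<mu>_def)
    \<comment> \<open>Here \<open>m\<close> is the mean number of vertices per greedy interval. Up
      to the loss, \<open>exp \<mu>\<close> splits into \<open>z ^ (r - 2)\<close> for the forced
      part and \<open>1 + \<theta> / p\<close> for the waiting time; then
      \<open>\<theta> \<le> z - 1\<close> closes the one-step inequality.\<close>
    have "p * exp \<mu> + (1 - p) * z ^ (r - 2) \<le> z ^ (r - 1)"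
    proof -
      have "\<mu> = \<theta> * (real r - 2) / (1 + \<epsilon> / 2) + \<theta> / p / (1 + \<epsilon> / 2)"
        by (simp add: \<mu>_def m_def distrib_left add_divide_distrib)
      also have "\<dots> \<le> \<theta> * (real r - 2) + \<theta> / p / (1 + \<epsilon> / 2)"
      proof -
        have "\<theta> * (real r - 2) / (1 + \<epsilon> / 2) \<le> \<theta> * (real r - 2) / 1"
          using \<theta> r \<epsilon> by (intro divide_left_mono mult_nonneg_nonneg) auto
        then show ?thesis
          by simp
      qed
      finally have "exp \<mu> \<le> exp (\<theta> * (real r - 2)) * exp (\<theta> / p / (1 + \<epsilon> / 2))"
        by (simp flip: exp_add)
      also have "\<dots> \<le> exp (\<theta> * (real r - 2)) * (1 + \<theta> / p)"
      proof (intro mult_left_mono exp_divide_le_add_one)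
        show "\<theta> / p \<le> \<epsilon> / 2"
          using p p0 \<epsilon> by (simp add: \<theta>_def field_simps mult_right_mono)
      qed (use \<theta> p0 in auto)
      also have "exp (\<theta> * (real r - 2)) = z ^ (r - 2)"
        using r by (simp add: z_def of_nat_diff mult.commute flip: exp_of_nat_mult)
      finally have "p * exp \<mu> \<le> p * (z ^ (r - 2) * (1 + \<theta> / p))"
        using p0 by (intro mult_left_mono) auto
      also have "\<dots> = z ^ (r - 2) * (p + \<theta>)"
        using p0 by (simp add: field_simps)
      also have "\<dots> \<le> z ^ (r - 2) * (p + (z - 1))"
      proof -
        have "\<theta> \<le> z - 1"
          using exp_ge_add_one_self[of \<theta>] unfolding z_def by linarith
        then show ?thesis
          by (intro mult_left_mono add_left_mono) (auto simp: z_def)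
      qed
      finally have "p * exp \<mu> + (1 - p) * z ^ (r - 2) \<le> z * z ^ (r - 2)"
        by (simp add: algebra_simps)
      also have "z * z ^ (r - 2) = z ^ (r - 1)"
      proof -
        have "Suc (r - 2) = r - 1"
          using r by simp
        then show ?thesis
          by (metis power_Suc)
      qed
      finally show ?thesis .
    qed
    then have E: "measure_pmf.expectation (random_hypergraph r n p) (\<lambda>H. exp \<mu> ^ greedy_intervals r n H 1)
        \<le> z ^ (n + r - 1)"
      using r p0 p n \<mu> \<theta> by (intro expectation_greedy_intervals_le) (auto simp: z_def)
    have big: "exp (\<mu> * ((1 + \<epsilon>) * real n / m)) \<le> exp \<mu> ^ greedy_intervals r n H 1"
      if "(1 + \<epsilon>) * real n * (1 / real r + 1 / (real r * m)) < real (max_path_length r n H)" for H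
    proof -
      let ?l = "max_path_length r n H"
      have "\<exists>w. ordered_loose_path r n H ?l w"
        using Max_in[OF finite_path_lengths[OF r] path_lengths_nonempty[OF n]]
        unfolding max_path_length_def by blast
      then have "r * ?l \<le> n + greedy_intervals r n H 1"
        using path_length_le_greedy_intervals[OF r] by blast
      then have "real r * real ?l \<le> real n + real (greedy_intervals r n H 1)"
        by (metis of_nat_add of_nat_le_iff of_nat_mult)
      moreover have "(1 + \<epsilon>) * real n + (1 + \<epsilon>) * real n / m < real r * real ?l"
      proof -
        have "real r * ((1 + \<epsilon>) * real n * (1 / real r + 1 / (real r * m))) < real r * real ?l"
          using that r by (intro mult_strict_left_mono) auto
        moreover have "real r * ((1 + \<epsilon>) * real n * (1 / real r + 1 / (real r * m))) =
            (1 + \<epsilon>) * real n + (1 + \<epsilon>) * real n / m"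
          using r m by (simp add: field_simps)
        ultimately show ?thesis
          by simp
      qed
      \<comment> \<open>The surplus \<open>\<epsilon> * real n\<close> of this term is given away;
        the relative surplus in the interval count alone suffices.\<close>
      moreover have "real n \<le> (1 + \<epsilon>) * real n"
        using \<epsilon> by (simp add: mult_le_cancel_right1)
      ultimately have "(1 + \<epsilon>) * real n / m \<le> real (greedy_intervals r n H 1)"
        by linarith
      then have "\<mu> * ((1 + \<epsilon>) * real n / m) \<le> \<mu> * real (greedy_intervals r n H 1)"
        using \<mu> by (intro mult_left_mono) auto
      then show ?thesis
        by (simp add: mult.commute[of "real _" \<mu>] flip: exp_of_nat_mult)
    qed
    have "measure_pmf.prob (random_hypergraph r n p)
        {H. (1 + \<epsilon>) * real n * (1 / real r + 1 / (real r * m)) < real (max_path_length r n H)}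
        \<le> measure_pmf.expectation (random_hypergraph r n p) (\<lambda>H. exp \<mu> ^ greedy_intervals r n H 1) /
          exp (\<mu> * ((1 + \<epsilon>) * real n / m))"
      using big by (intro prob_random_hypergraph_Markov) auto
    also have "\<dots> \<le> z ^ (n + r - 1) / exp (\<mu> * ((1 + \<epsilon>) * real n / m))"
      using E by (intro divide_right_mono) auto
    also have "z ^ (n + r - 1) = exp (\<theta> * (real n + (real r - 1)))"
      using r by (simp add: z_def of_nat_diff algebra_simps flip: exp_of_nat_mult)
    also have "\<mu> * ((1 + \<epsilon>) * real n / m) = \<theta> * real n + \<gamma> * real n"
    proof -
      define b where "b = \<theta> / (1 + \<epsilon> / 2)"
      have b: "\<theta> = b * (1 + \<epsilon> / 2)" "\<gamma> = b * (\<epsilon> / 2)" "\<mu> = b * m"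
        using \<epsilon> by (simp_all add: b_def \<mu>_def \<gamma>_def)
      have "\<mu> * ((1 + \<epsilon>) * real n / m) = b * ((1 + \<epsilon>) * real n)"
        using m by (simp add: b(3))
      also have "\<dots> = \<theta> * real n + \<gamma> * real n"
        unfolding b(1,2) by (simp add: algebra_simps)
      finally show ?thesis .
    qed
    also have "exp (\<theta> * (real n + (real r - 1))) / exp (\<theta> * real n + \<gamma> * real n) =
        exp (\<theta> * (real r - 1)) * exp (- \<gamma> * real n)"
      by (simp add: algebra_simps flip: exp_diff exp_add)
    finally show ?thesis
      by (simp only: m_def)
  qed
  ultimately show ?thesis
    by blast
qed

section \<open>The lower denominator and the lower tail\<close>

definition lower_denominator :: "nat \<Rightarrow> real \<Rightarrow> real" where
  "lower_denominator r p = real r - p - real r * (1 - p) ^ r + (p * real r + 1) * (1 - p) ^ r / p ^ 2"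

text \<open>The difference of the two sides is
  \<open>(1 - p) ^ r * (1 / p - 1) * (r + 1 / p)\<close>, which is nonnegative. The left side bounds
  the mean advance of the greedy path.\<close>

lemma lower_denominator_ge:
  assumes "0 < p" "p \<le> 1"
  shows "real r - 1 + ((1 - p) + (1 - p) ^ r / p) \<le> lower_denominator r p"
proof -
  have "real r * 1 \<le> real r * (1 / p)"
    using assms by (intro mult_left_mono) auto
  moreover have "1 / p * 1 \<le> 1 / p * (1 / p)"
    using assms by (intro mult_left_mono) auto
  ultimately have "0 \<le> (1 - p) ^ r * (real r / p + 1 / p ^ 2 - 1 / p - real r)"
    using assms by (intro mult_nonneg_nonneg) (auto simp: power2_eq_square)
  also have "\<dots> = lower_denominator r p - (real r - 1 + ((1 - p) + (1 - p) ^ r / p))"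
    using assms by (simp add: lower_denominator_def field_simps power2_eq_square)
  finally show ?thesis
    by simp
qed

lemma lower_denominator_pos:
  assumes "2 \<le> r" "0 < p" "p \<le> 1"
  shows "0 < lower_denominator r p"
proof -
  have "0 \<le> (1 - p) + (1 - p) ^ r / p"
    using assms by simp
  then show ?thesis
    using lower_denominator_ge[of p r] assms by linarith
qed

text \<open>A bound uniform in \<open>p \<ge> c\<close>, from which the constant \<open>C\<close> of
  the lower tail is built.\<close>

lemma lower_denominator_le:
  assumes "0 < c" "c \<le> p" "p \<le> 1"
  shows "lower_denominator r p \<le> real r + (real r + 1) / c ^ 2"
proof -
  have "(p * real r + 1) * (1 - p) ^ r / p ^ 2 \<le> (real r + 1) * 1 / c ^ 2"
    using assms by (intro frac_le mult_mono power_le_one power_mono) (auto simp: mult_left_le_one_le)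
  moreover have "0 \<le> real r * (1 - p) ^ r"
    using assms by simp
  ultimately show ?thesis
    using assms unfolding lower_denominator_def by linarith
qed

text \<open>Markov's inequality for \<open>y ^ greedy_length r n H 1\<close> with
  \<open>y < 1\<close>: a short greedy path makes this power large.\<close>

lemma max_path_length_lower_tail:
  fixes c \<epsilon> :: real
  assumes r: "r \<ge> 2" and c: "0 < c" and \<epsilon>: "0 < \<epsilon>" "\<epsilon> < 1"
  shows "\<exists>C \<gamma>. 0 < \<gamma> \<and> (\<forall>n p. c \<le> p \<longrightarrow> p \<le> 1 \<longrightarrow> 1 \<le> n \<longrightarrow>
    measure_pmf.prob (random_hypergraph r n p)
      {H. real (max_path_length r n H) < (1 - \<epsilon>) * real n / lower_denominator r p}
      \<le> C * exp (- \<gamma> * real n))"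
proof -
  \<comment> \<open>As \<open>\<theta>\<close> tends to 0 from the right, the expression tends to
    \<open>1 - (1 + \<epsilon>) < 0\<close>, so some positive \<open>\<theta>\<close> meets the
    inequality needed for \<open>z\<close> and \<open>\<delta>\<close> below.\<close>
  have "eventually (\<lambda>\<theta> :: real. exp \<theta> * exp \<theta> - (1 + \<epsilon>) * (1 - (exp \<theta> - 1) / c) < 0) (at_right 0)"
  proof (rule order_tendstoD)
    have "((\<lambda>\<theta> :: real. exp \<theta> * exp \<theta> - (1 + \<epsilon>) * (1 - (exp \<theta> - 1) / c)) \<longlongrightarrow>
        exp 0 * exp 0 - (1 + \<epsilon>) * (1 - (exp 0 - 1) / c)) (at_right 0)"
      using c by (intro tendsto_intros) auto
    then show "((\<lambda>\<theta> :: real. exp \<theta> * exp \<theta> - (1 + \<epsilon>) * (1 - (exp \<theta> - 1) / c)) \<longlongrightarrow> - \<epsilon>) (at_right 0)"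
      by simp
  qed (use \<epsilon> in simp)
  moreover have "eventually (\<lambda>\<theta> :: real. 0 < \<theta>) (at_right 0)"
    by (simp add: eventually_at_right_less)
  ultimately obtain \<theta> :: real where \<theta>: "0 < \<theta>"
    and \<theta>_le: "exp \<theta> * exp \<theta> < (1 + \<epsilon>) * (1 - (exp \<theta> - 1) / c)"
    using eventually_happens'[OF trivial_limit_at_right_real eventually_conj] that
    by (metis (no_types, lifting) diff_less_0_iff_less)
  define z where "z = exp \<theta>"
  define \<delta> where "\<delta> = (z - 1) / c"
  have z: "1 < z"
    using \<theta> by (simp add: z_def)
  have \<delta>: "0 < \<delta>" "z * z \<le> (1 + \<epsilon>) * (1 - \<delta>)"
    using \<theta>_le z c by (auto simp: \<delta>_def z_def)
  have "0 < (1 + \<epsilon>) * (1 - \<delta>)"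
    using \<delta>(2) z by (smt (verit) mult_pos_pos)
  then have \<delta>1: "\<delta> < 1"
    using \<epsilon> by (simp add: zero_less_mult_iff)
  define \<gamma> where "\<gamma> = \<theta> * \<epsilon>\<^sup>2"
  define C where "C = exp ((1 + \<epsilon>) * \<theta> * (real r + (real r + 1) / c\<^sup>2))"
  have "0 < \<gamma>"
    using \<theta> \<epsilon> by (simp add: \<gamma>_def)
  moreover have "measure_pmf.prob (random_hypergraph r n p)
      {H. real (max_path_length r n H) < (1 - \<epsilon>) * real n / lower_denominator r p}
      \<le> C * exp (- \<gamma> * real n)"
    if p: "c \<le> p" "p \<le> 1" and n: "1 \<le> n" for n :: nat and p :: real
  proof -
    have p0: "0 < p"
      using c p by linarith
    define q where "q = 1 - p"
    have q: "0 \<le> q" "q \<le> 1"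
      using p p0 by (auto simp: q_def)
    define D where "D = lower_denominator r p"
    have D: "0 < D"
      using lower_denominator_pos[OF r p0 p(2)] by (simp add: D_def)
    define \<mu> where "\<mu> = (1 + \<epsilon>) * \<theta> * D"
    define y where "y = exp (- \<mu>)"
    \<comment> \<open>The geometric series has denominator
      \<open>1 - q * z = p - q * (z - 1)\<close>; since
      \<open>z - 1 = c * \<delta> \<le> p * \<delta>\<close>, it differs from \<open>p\<close> by a
      factor of at least \<open>1 - \<delta>\<close>, uniformly in \<open>p\<close>.\<close>
    have gap: "p * (1 - \<delta>) \<le> 1 - q * z"
    proof -
      have "q * (z - 1) \<le> 1 * (z - 1)"
        using q z by (intro mult_right_mono) auto
      also have "\<dots> = c * \<delta>"
        using c by (simp add: \<delta>_def)
      also have "\<dots> \<le> p * \<delta>"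
        using p \<delta> by (intro mult_right_mono) auto
      finally show ?thesis
        by (simp add: q_def algebra_simps)
    qed
    have gap_pos: "0 < p * (1 - \<delta>)"
      using p0 \<delta>1 by simp
    have z_le: "z - 1 \<le> \<theta> * z"
      using exp_ge_add_one_self[of "- \<theta>"] z by (simp add: z_def exp_minus field_simps)
    \<comment> \<open>All losses are collected in the factor \<open>z * z / (1 - \<delta>)\<close>,
      which the choice of \<open>\<theta>\<close> keeps below \<open>1 + \<epsilon>\<close>.\<close>
    have "(z - 1) * (q + z * q ^ r / (1 - q * z)) \<le> \<theta> * z * (z / (1 - \<delta>) * (q + q ^ r / p))"
    proof (intro mult_mono)
      have "z * q ^ r / (1 - q * z) \<le> z * q ^ r / (p * (1 - \<delta>))"
        using gap gap_pos z q by (intro divide_left_mono) auto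
      also have "\<dots> = z / (1 - \<delta>) * (q ^ r / p)"
        by simp
      finally have "z * q ^ r / (1 - q * z) \<le> z / (1 - \<delta>) * (q ^ r / p)" .
      moreover have "1 * q \<le> z / (1 - \<delta>) * q"
        using \<delta> \<delta>1 z q by (intro mult_right_mono) auto
      ultimately show "q + z * q ^ r / (1 - q * z) \<le> z / (1 - \<delta>) * (q + q ^ r / p)"
        by (simp add: distrib_left)
      show "0 \<le> q + z * q ^ r / (1 - q * z)"
        using gap gap_pos z q by simp
    qed (use z_le \<theta> z in auto)
    also have "\<dots> = \<theta> * (z * z / (1 - \<delta>)) * (q + q ^ r / p)"
      by simp
    also have "\<dots> \<le> \<theta> * (1 + \<epsilon>) * (q + q ^ r / p)"
      using \<delta> \<delta>1 \<theta> q p0 by (intro mult_right_mono mult_left_mono) (auto simp: divide_le_eq)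
    finally have step: "(z - 1) * (q + z * q ^ r / (1 - q * z)) \<le> \<theta> * (1 + \<epsilon>) * (q + q ^ r / p)" .
    have "z ^ (r - 1) * (1 + (z - 1) * (q + z * q ^ r / (1 - q * z))) \<le> exp \<mu>"
    proof -
      have "1 + (z - 1) * (q + z * q ^ r / (1 - q * z)) \<le> exp (\<theta> * (1 + \<epsilon>) * (q + q ^ r / p))"
        using step exp_ge_add_one_self[of "\<theta> * (1 + \<epsilon>) * (q + q ^ r / p)"] by linarith
      then have "z ^ (r - 1) * (1 + (z - 1) * (q + z * q ^ r / (1 - q * z))) \<le>
          z ^ (r - 1) * exp (\<theta> * (1 + \<epsilon>) * (q + q ^ r / p))"
        using z by (intro mult_left_mono) auto
      also have "\<dots> = exp (\<theta> * (real r - 1) + \<theta> * (1 + \<epsilon>) * (q + q ^ r / p))"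
        using r by (simp add: z_def exp_add of_nat_diff mult.commute flip: exp_of_nat_mult)
      also have "\<dots> \<le> exp \<mu>"
      proof -
        have "\<theta> * (real r - 1) \<le> \<theta> * (1 + \<epsilon>) * (real r - 1)"
          using r \<theta> \<epsilon> by (intro mult_right_mono) auto
        then have "\<theta> * (real r - 1) + \<theta> * (1 + \<epsilon>) * (q + q ^ r / p) \<le>
            \<theta> * (1 + \<epsilon>) * (real r - 1 + (q + q ^ r / p))"
          by (simp only: distrib_left)
        also have "\<dots> \<le> \<theta> * (1 + \<epsilon>) * D"
          using lower_denominator_ge[OF p0 p(2), of r] \<theta> \<epsilon>
          by (intro mult_left_mono) (auto simp: D_def q_def)
        finally show ?thesis
          by (simp add: \<mu>_def mult_ac)
      qed
      finally show ?thesis .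
    qed
    then have "y * (z ^ (r - 1) * (1 + (z - 1) * (q + z * q ^ r / (1 - q * z)))) \<le> y * exp \<mu>"
      by (intro mult_left_mono) (auto simp: y_def)
    then have yz: "y * (z ^ (r - 1) * (1 + (z - 1) * (q + z * q ^ r / (1 - q * z)))) \<le> 1"
      by (simp add: y_def exp_minus)
    have E: "measure_pmf.expectation (random_hypergraph r n p) (\<lambda>H. y ^ greedy_length r n H 1)
        \<le> z ^ 1 / (y * z ^ Suc n)"
    proof (rule expectation_greedy_length_le[OF r _ p(2)])
      show "(1 - p) * z < 1"
        using gap gap_pos unfolding q_def by linarith
    qed (use p0 z n yz in \<open>auto simp: q_def y_def\<close>)
    have big: "exp (- \<mu> * ((1 - \<epsilon>) * real n / D)) \<le> y ^ greedy_length r n H 1"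
      if "real (max_path_length r n H) < (1 - \<epsilon>) * real n / D" for H
    proof -
      have "real (greedy_length r n H 1) \<le> (1 - \<epsilon>) * real n / D"
        using greedy_length_le_max_path_length[OF r n, of H] that by linarith
      moreover have "0 \<le> \<mu>"
        using \<theta> \<epsilon> D by (simp add: \<mu>_def)
      ultimately have "\<mu> * real (greedy_length r n H 1) \<le> \<mu> * ((1 - \<epsilon>) * real n / D)"
        by (rule mult_left_mono)
      then show ?thesis
        by (simp add: y_def mult.commute flip: exp_of_nat_mult)
    qed
    have "measure_pmf.prob (random_hypergraph r n p)
        {H. real (max_path_length r n H) < (1 - \<epsilon>) * real n / D}
        \<le> measure_pmf.expectation (random_hypergraph r n p) (\<lambda>H. y ^ greedy_length r n H 1) /
          exp (- \<mu> * ((1 - \<epsilon>) * real n / D))"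
      using big by (intro prob_random_hypergraph_Markov) (auto simp: y_def)
    also have "\<dots> \<le> z ^ 1 / (y * z ^ Suc n) / exp (- \<mu> * ((1 - \<epsilon>) * real n / D))"
      using E by (intro divide_right_mono) auto
    also have "\<dots> = exp \<mu> * exp (- \<gamma> * real n)"
    proof -
      \<comment> \<open>Since
        \<open>(1 + \<epsilon>) * (1 - \<epsilon>) = 1 - \<epsilon>\<^sup>2\<close>, the decay rate
        left after cancelling \<open>\<theta> * real n\<close> is
        \<open>\<theta> * \<epsilon>\<^sup>2\<close>, which is \<open>\<gamma>\<close>.\<close>
      have "- \<mu> * ((1 - \<epsilon>) * real n / D) = \<gamma> * real n - \<theta> * real n"
      proof -
        have "- \<mu> * ((1 - \<epsilon>) * real n / D) = - ((1 + \<epsilon>) * \<theta>) * ((1 - \<epsilon>) * real n)"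
          using D by (simp add: \<mu>_def)
        then show ?thesis
          by (simp add: \<gamma>_def power2_eq_square algebra_simps)
      qed
      moreover have "z ^ 1 / (y * z ^ Suc n) = exp (\<mu> - \<theta> * real n)"
        using exp_of_nat_mult[of n \<theta>] by (simp add: y_def z_def exp_minus exp_diff field_simps)
      ultimately show ?thesis
        by (simp flip: exp_diff exp_add)
    qed
    also have "\<dots> \<le> C * exp (- \<gamma> * real n)"
    proof (intro mult_right_mono)
      show "exp \<mu> \<le> C"
        using lower_denominator_le[OF c p, of r] \<theta> \<epsilon> by (simp add: C_def \<mu>_def D_def)
    qed simp
    finally show ?thesis
      by (simp only: D_def)
  qed
  ultimately show ?thesis
    by blast
qed

section \<open>From fixed relative errors to vanishing ones\<close>

text \<open>Take for \<open>k n\<close> the largest \<open>k \<le> n\<close> whose sequence is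
  within \<open>1 / Suc k\<close> of the limit from \<open>n\<close> on. Every fixed level is
  reached eventually, so \<open>k n\<close> diverges and the error along the diagonal
  vanishes.\<close>

lemma tendsto_diagonal:
  fixes P :: "nat \<Rightarrow> nat \<Rightarrow> real"
  assumes "\<And>k. P k \<longlonglongrightarrow> L"
  shows "\<exists>k. filterlim k at_top sequentially \<and> (\<lambda>n. P (k n) n) \<longlonglongrightarrow> L"
proof -
  \<comment> \<open>The inserted 0 keeps the set nonempty and \<open>k \<le> n\<close> keeps it
    finite, so that \<open>Max\<close> is meaningful.\<close>
  define S where "S n = insert 0 {k. k \<le> n \<and> (\<forall>m\<ge>n. \<bar>P k m - L\<bar> \<le> 1 / real (Suc k))}" for n
  define k where "k n = Max (S n)" for n
  have fin: "finite (S n)" for n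
    by (rule finite_subset[of _ "{..n}"]) (auto simp: S_def)
  have k_ge: "eventually (\<lambda>n. K \<le> k n) sequentially" for K
  proof -
    have "eventually (\<lambda>m. \<bar>P K m - L\<bar> < 1 / real (Suc K)) sequentially"
      using tendstoD[OF assms[of K], of "1 / real (Suc K)"] by (simp add: dist_real_def)
    then obtain N where N: "\<And>m. m \<ge> N \<Longrightarrow> \<bar>P K m - L\<bar> < 1 / real (Suc K)"
      by (auto simp: eventually_sequentially)
    have "K \<le> k n" if "n \<ge> max K N" for n
      unfolding k_def using N that fin by (intro Max_ge) (auto simp: S_def intro: less_imp_le)
    then show ?thesis
      unfolding eventually_sequentially by blast
  qed
  then have k_lim: "filterlim k at_top sequentially"
    by (simp add: filterlim_at_top)
  \<comment> \<open>Requiring \<open>k n \<ge> 1\<close> excludes the inserted 0, whose membership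
    carries no estimate.\<close>
  have "eventually (\<lambda>n. norm (P (k n) n - L) \<le> 1 / real (Suc (k n))) sequentially"
    using k_ge[of 1]
  proof eventually_elim
    case (elim n)
    have "k n \<in> S n"
      unfolding k_def by (rule Max_in[OF fin]) (simp add: S_def)
    then show ?case
      using elim by (auto simp: S_def)
  qed
  moreover have "(\<lambda>n. 1 / real (Suc (k n))) \<longlonglongrightarrow> 0"
    using filterlim_compose[OF LIMSEQ_Suc[OF lim_1_over_n] k_lim] by simp
  ultimately have "(\<lambda>n. P (k n) n - L) \<longlonglongrightarrow> 0"
    by (rule Lim_null_comparison)
  then show ?thesis
    using k_lim LIM_zero_iff by blast
qed

lemma max_path_length_bounds_tendsto:
  fixes r :: nat and p :: "nat \<Rightarrow> real" and c \<epsilon> :: real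
  assumes r: "r \<ge> 2" and c: "0 < c" and p: "\<forall>\<^sub>F n in sequentially. c \<le> p n \<and> p n \<le> 1"
    and \<epsilon>: "0 < \<epsilon>" "\<epsilon> < 1"
  shows "(\<lambda>n. measure_pmf.prob (random_hypergraph r n (p n))
       {H. (1 - \<epsilon>) * real n / lower_denominator r (p n) \<le> real (max_path_length r n H)
         \<and> real (max_path_length r n H)
             \<le> (1 + \<epsilon>) * real n * (1 / real r + 1 / (real r * (real r - 2 + 1 / p n)))})
      \<longlonglongrightarrow> 1" (is "(\<lambda>n. measure_pmf.prob _ (?good n)) \<longlonglongrightarrow> 1")
proof -
  let ?prob = "\<lambda>n. measure_pmf.prob (random_hypergraph r n (p n))"
  obtain C1 \<gamma>1 where 1: "0 < \<gamma>1" "\<And>n p. c \<le> p \<Longrightarrow> p \<le> 1 \<Longrightarrow> 1 \<le> n \<Longrightarrow>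
    measure_pmf.prob (random_hypergraph r n p)
      {H. (1 + \<epsilon>) * real n * (1 / real r + 1 / (real r * (real r - 2 + 1 / p))) < real (max_path_length r n H)}
      \<le> C1 * exp (- \<gamma>1 * real n)"
    using max_path_length_upper_tail[OF r c \<epsilon>(1)] by blast
  obtain C2 \<gamma>2 where 2: "0 < \<gamma>2" "\<And>n p. c \<le> p \<Longrightarrow> p \<le> 1 \<Longrightarrow> 1 \<le> n \<Longrightarrow>
    measure_pmf.prob (random_hypergraph r n p)
      {H. real (max_path_length r n H) < (1 - \<epsilon>) * real n / lower_denominator r p}
      \<le> C2 * exp (- \<gamma>2 * real n)"
    using max_path_length_lower_tail[OF r c \<epsilon>] by blast
  have exp_lim: "(\<lambda>n. C * exp (- \<gamma> * real n)) \<longlonglongrightarrow> 0" if "0 < \<gamma>" for C \<gamma> :: real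
  proof -
    have "(\<lambda>n. C * exp (- \<gamma>) ^ n) \<longlonglongrightarrow> 0"
      using that by (intro tendsto_mult_right_zero LIMSEQ_power_zero) simp
    then show ?thesis
      by (simp add: mult.commute flip: exp_of_nat_mult)
  qed
  show ?thesis
  proof (rule real_tendsto_sandwich)
    show "\<forall>\<^sub>F n in sequentially. 1 - (C1 * exp (- \<gamma>1 * real n) + C2 * exp (- \<gamma>2 * real n)) \<le> ?prob n (?good n)"
      using p eventually_ge_at_top[of 1]
    proof eventually_elim
      case (elim n)
      let ?up = "{H. (1 + \<epsilon>) * real n * (1 / real r + 1 / (real r * (real r - 2 + 1 / p n))) < real (max_path_length r n H)}"
      let ?low = "{H. real (max_path_length r n H) < (1 - \<epsilon>) * real n / lower_denominator r (p n)}"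
      \<comment> \<open>Union bound: the good event and the two tail events cover the whole
        space.\<close>
      have "1 = ?prob n (?good n \<union> (?up \<union> ?low))"
      proof -
        have "?good n \<union> (?up \<union> ?low) = UNIV"
          by auto
        then show ?thesis
          by (metis measure_pmf.prob_space space_measure_pmf)
      qed
      also have "\<dots> \<le> ?prob n (?good n) + ?prob n (?up \<union> ?low)"
        by (rule measure_subadditive) auto
      also have "?prob n (?up \<union> ?low) \<le> ?prob n ?up + ?prob n ?low"
        by (rule measure_subadditive) auto
      finally show ?case
        using 1(2)[of "p n" n] 2(2)[of "p n" n] elim by linarith
    qed
    show "\<forall>\<^sub>F n in sequentially. ?prob n (?good n) \<le> 1"
      by simp
    show "(\<lambda>n. 1 - (C1 * exp (- \<gamma>1 * real n) + C2 * exp (- \<gamma>2 * real n))) \<longlonglongrightarrow> 1"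
      using tendsto_diff[OF tendsto_const[of 1] tendsto_add[OF exp_lim[OF 1(1), of C1] exp_lim[OF 2(1), of C2]]]
      by simp
  qed simp
qed

theorem theorem1p1:
  fixes r :: nat and p :: "nat \<Rightarrow> real"
  assumes "r \<ge> 2"
    and "\<And>n. 0 \<le> p n \<and> p n \<le> 1"
    and "p \<in> \<Omega>(\<lambda>_. 1)"
    and "\<exists>\<epsilon> :: nat \<Rightarrow> real. \<epsilon> \<longlonglongrightarrow> 0 \<and> (\<forall>\<^sub>F n in sequentially. p n \<le> 1 - \<epsilon> n)"
  shows "\<exists>\<alpha> \<beta> :: nat \<Rightarrow> real. \<alpha> \<longlonglongrightarrow> 1 \<and> \<beta> \<longlonglongrightarrow> 1 \<and>
    (\<lambda>n. measure_pmf.prob (random_hypergraph r n (p n))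
       {H. \<alpha> n * real n /
             (real r - p n - real r * (1 - p n) ^ r
               + (p n * real r + 1) * (1 - p n) ^ r / (p n) ^ 2)
             \<le> real (max_path_length r n H)
         \<and> real (max_path_length r n H)
             \<le> \<beta> n * real n * (1 / real r + 1 / (real r * (real r - 2 + 1 / p n)))})
      \<longlonglongrightarrow> 1"
proof -
  obtain c where c: "0 < c" "\<forall>\<^sub>F n in sequentially. c * norm (1 :: real) \<le> norm (p n)"
    using assms(3) by (elim landau_omega.bigE)
  have p: "\<forall>\<^sub>F n in sequentially. c \<le> p n \<and> p n \<le> 1"
    using c(2) by eventually_elim (use assms(2) in auto)
  \<comment> \<open>The double successor keeps every \<open>e k\<close> strictly below 1, as the
    lower tail requires.\<close>
  define e where "e k = 1 / real (Suc (Suc k))" for k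
  have e: "0 < e k" "e k < 1" for k
    by (auto simp: e_def)
  define P where "P k n = measure_pmf.prob (random_hypergraph r n (p n))
       {H. (1 - e k) * real n / lower_denominator r (p n) \<le> real (max_path_length r n H)
         \<and> real (max_path_length r n H)
             \<le> (1 + e k) * real n * (1 / real r + 1 / (real r * (real r - 2 + 1 / p n)))}" for k n
  have "P k \<longlonglongrightarrow> 1" for k
    unfolding P_def by (rule max_path_length_bounds_tendsto[OF assms(1) c(1) p e])
  then obtain k where k: "filterlim k at_top sequentially" "(\<lambda>n. P (k n) n) \<longlonglongrightarrow> 1"
    using tendsto_diagonal by blast
  have "e \<longlonglongrightarrow> 0"
    unfolding e_def by (intro LIMSEQ_Suc[OF LIMSEQ_Suc[OF lim_1_over_n]])
  then have "(\<lambda>n. e (k n)) \<longlonglongrightarrow> 0"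
    using k(1) filterlim_compose by blast
  then have "(\<lambda>n. 1 - e (k n)) \<longlonglongrightarrow> 1" "(\<lambda>n. 1 + e (k n)) \<longlonglongrightarrow> 1"
    using tendsto_diff[OF tendsto_const[of 1]] tendsto_add[OF tendsto_const[of 1]] by fastforce+
  then show ?thesis
    using k(2) unfolding P_def lower_denominator_def by blast
qed

end
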